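(* Let $b>0$. For every constant $e>0$, the optimal evacuation time for problem $\mathcal{W}(b,e)$ is $\Omega(d^{3/2})$, asymptotically in $d$; that is, for any algorithm whose makespan evacuation energy is at most $e$ on every instance, the evacuation time on instances at distance $d$ is $\Omega(d^{3/2})$ as $d\to\infty$.
   Context: Two robots start at the origin of the infinite real line. An exit is placed at an unknown point at distance $d>0$ from the origin (either at $d$ or at $-d$; either placement is called an instance $d$). A robot finds the exit if and only if it walks over it. Robots may change speed and direction at any time, and communicate wirelessly: messages are transmitted instantaneously at any distance. The evacuation time is the time at which the last robot reaches the exit. A robot moving in one direction from $a$ to $b$ with speed $s(x)$ at position $x$ uses energy $\int_a^b s(x)^2\,dx$ (so $xs^2$ for constant speed $s$ over length $x$), and energies of successive intervals add up. The makespan evacuation energy is the maximum of the two robots' energies used until both have reached the exit. Problem $\mathcal{W}(b,e)$: minimize the evacuation time over algorithms using speeds at most $b$ whose makespan evacuation energy is at most $e$ for every instance $d$. *)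

theory Defs
  imports "HOL-Analysis.Analysis" "HOL-Library.Landau_Symbols"
begin

text \<open>A motion \<open>X\<close> gives the position of a robot at each time \<open>t \<ge> 0\<close>. On a leg the robot either
  waits or moves in one direction. The speed is only required at almost every time, so that it may
  change abruptly; a Lipschitz motion has such a speed automatically.\<close>

definition leg :: "(real \<Rightarrow> real) \<Rightarrow> real \<Rightarrow> real \<Rightarrow> bool" where
  "leg X u v \<longleftrightarrow> u \<le> v \<and>
     (X constant_on {u..v} \<or> strict_mono_on {u..v} X \<or> strict_antimono_on {u..v} X) \<and>
     negligible {t \<in> {u..v}. \<not> X differentiable (at t)}"

definition speed_at :: "(real \<Rightarrow> real) \<Rightarrow> real \<Rightarrow> real \<Rightarrow> real \<Rightarrow> real" where
  "speed_at X u v x = \<bar>deriv X (the_inv_into {u..v} X x)\<bar>"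

text \<open>The integral is over positions, not over time. A waiting leg covers a single
  point and hence costs nothing. For a Lipschitz motion the positions at which the speed is not
  defined form a null set.\<close>

definition leg_energy :: "(real \<Rightarrow> real) \<Rightarrow> real \<Rightarrow> real \<Rightarrow> real" where
  "leg_energy X u v = integral (X ` {u..v}) (\<lambda>x. (speed_at X u v x)\<^sup>2)"

inductive uses_energy :: "(real \<Rightarrow> real) \<Rightarrow> real \<Rightarrow> real \<Rightarrow> real \<Rightarrow> bool" for X where
  single: "leg X u v \<Longrightarrow> uses_energy X u v (leg_energy X u v)"
| successive: "uses_energy X u v E \<Longrightarrow> uses_energy X v w F \<Longrightarrow> uses_energy X u w (E + F)"

text \<open>For a Lipschitz motion the energy does not depend on how the time interval is cut into legs.\<close>

definition energy :: "(real \<Rightarrow> real) \<Rightarrow> real \<Rightarrow> real" where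
  "energy X T = (THE E. uses_energy X 0 T E)"

text \<open>Speed at most \<open>b\<close> is expressed by the Lipschitz constant. Within bounded time a robot changes
  between waiting and moving left or right only finitely often.\<close>

definition trajectory :: "real \<Rightarrow> (real \<Rightarrow> real) \<Rightarrow> bool" where
  "trajectory b X \<longleftrightarrow> X 0 = 0 \<and> b-lipschitz_on {0..} X \<and> (\<forall>T\<ge>0. \<exists>E. uses_energy X 0 T E)"

datatype robot = R1 | R2

text \<open>\<open>A (Some p) i\<close> is the motion of robot \<open>i\<close> if the exit is at \<open>p\<close>, and \<open>A None i\<close> is its motion
  as long as no exit has been found.\<close>

type_synonym algorithm = "real option \<Rightarrow> robot \<Rightarrow> real \<Rightarrow> real"

text \<open>The last but one condition expresses both the ignorance of the exit position and the wireless
  communication: until one of the robots walks over the exit, both move as if there were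
  none; from that moment on, both may react to its position.\<close>

definition evacuation_algorithm :: "real \<Rightarrow> algorithm \<Rightarrow> bool" where
  "evacuation_algorithm b A \<longleftrightarrow>
     (\<forall>i. trajectory b (A None i)) \<and>
     (\<forall>p i. p \<noteq> 0 \<longrightarrow> trajectory b (A (Some p) i)) \<and>
     (\<forall>p t. p \<noteq> 0 \<longrightarrow> 0 \<le> t \<longrightarrow> (\<forall>s j. 0 \<le> s \<longrightarrow> s < t \<longrightarrow> A None j s \<noteq> p) \<longrightarrow>
        (\<forall>i. A (Some p) i t = A None i t)) \<and>
     (\<forall>p i. p \<noteq> 0 \<longrightarrow> (\<exists>t\<ge>0. A (Some p) i t = p))"

definition arrival_time :: "algorithm \<Rightarrow> real \<Rightarrow> robot \<Rightarrow> real" where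
  "arrival_time A p i = Inf {t. 0 \<le> t \<and> A (Some p) i t = p}"

definition evacuation_time :: "algorithm \<Rightarrow> real \<Rightarrow> real" where
  "evacuation_time A p = max (arrival_time A p R1) (arrival_time A p R2)"

definition makespan_energy :: "algorithm \<Rightarrow> real \<Rightarrow> real" where
  "makespan_energy A p =
     max (energy (A (Some p) R1) (evacuation_time A p))
         (energy (A (Some p) R2) (evacuation_time A p))"

definition W :: "real \<Rightarrow> real \<Rightarrow> algorithm set" where
  "W b e = {A. evacuation_algorithm b A \<and>
     (\<forall>d>0. makespan_energy A d \<le> e \<and> makespan_energy A (- d) \<le> e)}"

text \<open>The optimum is over algorithms that do not know on which side the exit is, so the worse of
  the two placements counts. The infimum over an empty set of algorithms is \<open>\<infinity>\<close>.\<close>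

definition optimal_evacuation_time :: "real \<Rightarrow> real \<Rightarrow> real \<Rightarrow> ereal" where
  "optimal_evacuation_time b e d =
     (INF A\<in>W b e. ereal (max (evacuation_time A d) (evacuation_time A (- d))))"

end

theory Submission
  imports Defs
begin

text \<open>Parametrised by time, the energy of a Lipschitz motion \<open>X\<close> up to time \<open>T\<close> is the integral of
  \<open>\<bar>X'\<bar>\<^sup>3\<close>. Since \<open>s\<^sup>3 \<ge> 3 \<lambda>\<^sup>2 s - 2 \<lambda>\<^sup>3\<close> for \<open>s, \<lambda> \<ge> 0\<close>, a motion that covers
  distance \<open>d\<close> in time \<open>T\<close> uses energy at least \<open>3 \<lambda>\<^sup>2 d - 2 \<lambda>\<^sup>3 T\<close>; the choice \<open>\<lambda> = d / T\<close> gives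
  \<open>d\<^sup>3 / T\<^sup>2\<close>. Hence a robot with energy at most \<open>e\<close> needs time at least \<open>d\<^bsup>3/2\<^esup> / \<surd>e\<close>
  to reach an exit at distance \<open>d\<close>, even if it knows the exit.\<close>

section \<open>Lipschitz functions on the real line: derivatives and images\<close>

lemma lipschitz_on_abs_deriv_le:
  fixes f :: "real \<Rightarrow> real"
  assumes lip: "b-lipschitz_on S f" and t: "t \<in> interior S" and diff: "f differentiable (at t)"
  shows "\<bar>deriv f t\<bar> \<le> b"
proof -
  have "(f has_real_derivative deriv f t) (at t)"
    using diff by (simp add: DERIV_deriv_iff_real_differentiable)
  then have "((\<lambda>y. \<bar>(f y - f t) / (y - t)\<bar>) \<longlongrightarrow> \<bar>deriv f t\<bar>) (at t)"
    unfolding has_field_derivative_iff by (rule tendsto_rabs)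
  moreover have "eventually (\<lambda>y. y \<in> interior S) (at t)"
    using t by (simp add: eventually_at_in_open')
  then have "eventually (\<lambda>y. \<bar>(f y - f t) / (y - t)\<bar> \<le> b) (at t)"
    using eventually_neq_at_within[of t t UNIV]
  proof eventually_elim
    case (elim y)
    then have "\<bar>f y - f t\<bar> \<le> b * \<bar>y - t\<bar>"
      using lipschitz_onD[OF lip, of y t] t interior_subset by (auto simp: dist_real_def)
    with elim show ?case
      by (simp add: abs_divide divide_le_eq)
  qed
  ultimately show ?thesis
    by (rule tendsto_upperbound) simp
qed

lemma negligible_lipschitz_image:
  fixes f :: "'a::euclidean_space \<Rightarrow> 'a"
  assumes "b-lipschitz_on S f" "negligible N" "N \<subseteq> S"
  shows "negligible (f ` N)"
proof (rule negligible_locally_Lipschitz_image)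
  show "\<exists>T B. open T \<and> x \<in> T \<and> (\<forall>y\<in>N \<inter> T. norm (f y - f x) \<le> B * norm (y - x))"
    if "x \<in> N" for x
    using that assms lipschitz_onD[OF assms(1)]
    by (intro exI[of _ UNIV] exI[of _ b]) (auto simp: dist_norm)
qed (use assms in auto)

text \<open>By connectedness the image contains the whole segment between the two endpoint values;
  by compactness its measure is finite, so the two measures can be compared.\<close>

lemma abs_diff_le_measure_image:
  fixes f :: "real \<Rightarrow> real"
  assumes "u \<le> v" "continuous_on {u..v} f"
  shows "\<bar>f v - f u\<bar> \<le> measure lebesgue (f ` {u..v})"
proof -
  have "connected (f ` {u..v})" "compact (f ` {u..v})"
    using assms by (auto intro: connected_continuous_image compact_continuous_image)
  then have "{min (f u) (f v)..max (f u) (f v)} \<subseteq> f ` {u..v}"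
    using assms(1) by (intro connected_contains_Icc) (auto simp: min_def max_def)
  then have "measure lebesgue {min (f u) (f v)..max (f u) (f v)} \<le> measure lebesgue (f ` {u..v})"
    using \<open>compact _\<close> by (intro measure_mono_fmeasurable) (auto intro: lmeasurable_compact)
  then show ?thesis
    by (simp add: min_def max_def split: if_splits)
qed

section \<open>Energy of a leg as an integral over time\<close>

text \<open>Substituting \<open>x = X t\<close> in an integral over positions brings in the factor
  |X'|. The integrand s^2 thus becomes |X'|^3, and the integrand 1 becomes |X'|, whose integral is
  therefore the measure of the positions covered and dominates the net displacement.\<close>

lemma inj_lipschitz_energy:
  fixes X :: "real \<Rightarrow> real"
  assumes "u \<le> v" and lip: "b-lipschitz_on {u..v} X" and inj: "inj_on X {u..v}"
    and neg: "negligible {t \<in> {u..v}. \<not> X differentiable (at t)}"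
  shows "((\<lambda>t. \<bar>deriv X t\<bar> ^ 3) has_integral leg_energy X u v) {u..v}"
    and "(\<lambda>t. \<bar>deriv X t\<bar>) integrable_on {u..v}"
    and "\<bar>X v - X u\<bar> \<le> integral {u..v} (\<lambda>t. \<bar>deriv X t\<bar>)"
proof -
  \<comment> \<open>The change of variables needs a derivative at every point, so the exceptional
    times are removed; the endpoints go too, because the bound \<open>b\<close> on the derivative is
    available only in the interior.\<close>
  define S where "S = {t \<in> {u<..<v}. X differentiable (at t)}"
  have sub: "S \<subseteq> {u..v}"
    by (auto simp: S_def)
  have negS: "negligible ({u..v} - S)"
    by (rule negligible_subset[of "{t \<in> {u..v}. \<not> X differentiable (at t)} \<union> {u, v}"])
      (use neg in \<open>auto simp: S_def\<close>)
  have S: "S \<in> sets lebesgue"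
    by (rule sets_negligible_symdiff[of "{u..v}"]) (use negS sub in \<open>auto simp: Diff_eq_empty_iff[THEN iffD2]\<close>)
  have der: "(X has_field_derivative deriv X t) (at t within S)" if "t \<in> S" for t
    using that by (auto simp: S_def DERIV_deriv_iff_real_differentiable intro: has_field_derivative_at_within)
  have injS: "inj_on X S"
    using inj sub by (rule inj_on_subset)
  \<comment> \<open>A Lipschitz map sends null sets to null sets, so passing from
    \<open>{u..v}\<close> to \<open>S\<close> loses only a null set of positions.\<close>
  have negX: "negligible (X ` {u..v} - X ` S)"
    by (rule negligible_subset[OF negligible_lipschitz_image[OF lip negS]]) auto
  have bound: "\<bar>deriv X t\<bar> \<le> b" if "t \<in> S" for t
    using that by (intro lipschitz_on_abs_deriv_le[OF lip]) (auto simp: S_def)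
  have cont: "continuous_on {u..v} X"
    using lip by (rule lipschitz_on_continuous_on)
  have spike_t: "(f has_integral i) S \<longleftrightarrow> (f has_integral i) {u..v}" for f :: "real \<Rightarrow> real" and i
    by (rule has_integral_spike_set_eq; rule negligible_subset[OF negS]) (use sub in auto)
  have spike_x: "(f has_integral i) (X ` S) \<longleftrightarrow> (f has_integral i) (X ` {u..v})" for f :: "real \<Rightarrow> real" and i
    by (rule has_integral_spike_set_eq; rule negligible_subset[OF negX]) (use sub in auto)

  have meas: "X ` {u..v} \<in> lmeasurable"
    using cont by (intro lmeasurable_compact compact_continuous_image) auto
  then have "((\<lambda>x. 1::real) has_integral measure lebesgue (X ` {u..v})) (X ` S)"
    by (simp add: spike_x lmeasure_integral lmeasurable_iff_integrable_on has_integral_integral)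
  then have "(\<lambda>x. 1::real) absolutely_integrable_on (X ` S) \<and>
      integral (X ` S) (\<lambda>x. 1::real) = measure lebesgue (X ` {u..v})"
    by (auto simp: has_integral_iff intro!: nonnegative_absolutely_integrable_1)
  then have abs_int: "(\<lambda>t. \<bar>deriv X t\<bar>) absolutely_integrable_on S"
    and len: "integral S (\<lambda>t. \<bar>deriv X t\<bar>) = measure lebesgue (X ` {u..v})"
    using has_absolute_integral_change_of_variables_1'[OF S der injS, where f = "\<lambda>_. 1"] by auto
  then have "((\<lambda>t. \<bar>deriv X t\<bar>) has_integral measure lebesgue (X ` {u..v})) {u..v}"
    by (subst spike_t[symmetric]) (simp add: has_integral_iff set_lebesgue_integral_eq_integral)
  then show "(\<lambda>t. \<bar>deriv X t\<bar>) integrable_on {u..v}"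
    and "\<bar>X v - X u\<bar> \<le> integral {u..v} (\<lambda>t. \<bar>deriv X t\<bar>)"
    using abs_diff_le_measure_image[OF \<open>u \<le> v\<close> cont] by (auto simp: has_integral_iff)

  \<comment> \<open>The speed is at most \<open>b\<close> on \<open>S\<close>, so its cube is
    dominated by \<open>b\<^sup>2\<close> times the speed, already known to be integrable.\<close>
  have "(\<lambda>t. \<bar>deriv X t\<bar> ^ 3) absolutely_integrable_on S"
  proof (rule measurable_bounded_by_integrable_imp_absolutely_integrable[OF _ S])
    have "(\<lambda>t. \<bar>deriv X t\<bar>) \<in> borel_measurable (lebesgue_on S)"
      using abs_int S by (simp add: absolutely_integrable_measurable)
    then show "(\<lambda>t. \<bar>deriv X t\<bar> ^ 3) \<in> borel_measurable (lebesgue_on S)"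
      by (rule borel_measurable_power)
    show "(\<lambda>t. b\<^sup>2 * \<bar>deriv X t\<bar>) integrable_on S"
      using abs_int by (intro integrable_on_mult_right) (simp add: set_lebesgue_integral_eq_integral)
    show "norm (\<bar>deriv X t\<bar> ^ 3) \<le> b\<^sup>2 * \<bar>deriv X t\<bar>" if "t \<in> S" for t
      using power_mono[OF bound[OF that], of 2]
      by (simp add: power3_eq_cube power2_eq_square mult_right_mono)
  qed
  \<comment> \<open>Injectivity lets \<open>the_inv_into\<close> recover the time \<open>t\<close>
    from the position \<open>X t\<close>.\<close>
  moreover have eq: "\<bar>deriv X t\<bar> * (speed_at X u v (X t))\<^sup>2 = \<bar>deriv X t\<bar> ^ 3" if "t \<in> S" for t
    using the_inv_into_f_f[OF inj, of t] sub that
    by (auto simp: speed_at_def power3_eq_cube power2_eq_square)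
  ultimately have *: "(\<lambda>t. \<bar>deriv X t\<bar> * (speed_at X u v (X t))\<^sup>2) absolutely_integrable_on S \<and>
      integral S (\<lambda>t. \<bar>deriv X t\<bar> * (speed_at X u v (X t))\<^sup>2) = integral S (\<lambda>t. \<bar>deriv X t\<bar> ^ 3)"
    by (auto intro!: integral_cong cong: set_integrable_cong)
  \<comment> \<open>The change of variables is an equivalence; here it carries integrability from
    times to positions, whereas for the integrand 1 it went from positions to times.\<close>
  then have "(\<lambda>x. (speed_at X u v x)\<^sup>2) absolutely_integrable_on (X ` S) \<and>
      integral (X ` S) (\<lambda>x. (speed_at X u v x)\<^sup>2) = integral S (\<lambda>t. \<bar>deriv X t\<bar> ^ 3)"
    by (subst (asm) has_absolute_integral_change_of_variables_1'[OF S der injS])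
  then have "((\<lambda>x. (speed_at X u v x)\<^sup>2) has_integral integral S (\<lambda>t. \<bar>deriv X t\<bar> ^ 3)) (X ` {u..v})"
    by (subst spike_x[symmetric]) (simp add: has_integral_iff set_lebesgue_integral_eq_integral)
  then have "leg_energy X u v = integral S (\<lambda>t. \<bar>deriv X t\<bar> ^ 3)"
    by (simp add: leg_energy_def integral_unique)
  moreover have "(\<lambda>t. \<bar>deriv X t\<bar> ^ 3) integrable_on S"
    using \<open>(\<lambda>t. \<bar>deriv X t\<bar> ^ 3) absolutely_integrable_on S\<close>
    by (simp add: set_lebesgue_integral_eq_integral)
  ultimately show "((\<lambda>t. \<bar>deriv X t\<bar> ^ 3) has_integral leg_energy X u v) {u..v}"
    by (subst spike_t[symmetric]) (simp add: has_integral_integral)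
qed

text \<open>Strictly monotone legs are injective, so the change of variables covers them. On a
  waiting leg both the energy and the time integrals vanish.\<close>

lemma leg_has_integral:
  assumes leg: "leg X u v" and lip: "b-lipschitz_on {u..v} X"
  shows "((\<lambda>t. \<bar>deriv X t\<bar> ^ 3) has_integral leg_energy X u v) {u..v}"
    and "(\<lambda>t. \<bar>deriv X t\<bar>) integrable_on {u..v}"
    and "\<bar>X v - X u\<bar> \<le> integral {u..v} (\<lambda>t. \<bar>deriv X t\<bar>)"
proof -
  have uv: "u \<le> v" and neg: "negligible {t \<in> {u..v}. \<not> X differentiable (at t)}"
    using leg by (auto simp: leg_def)
  have "inj_on X {u..v}" if "strict_antimono_on {u..v} X"
  proof (rule linorder_inj_onI')
    show "X i \<noteq> X j" if "i \<in> {u..v}" "j \<in> {u..v}" "i < j" for i j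
      using monotone_onD[OF \<open>strict_antimono_on {u..v} X\<close> that] by simp
  qed
  then consider "X constant_on {u..v}" | "inj_on X {u..v}"
    using leg strict_mono_on_imp_inj_on unfolding leg_def by blast
  then have "((\<lambda>t. \<bar>deriv X t\<bar> ^ 3) has_integral leg_energy X u v) {u..v} \<and>
    (\<lambda>t. \<bar>deriv X t\<bar>) integrable_on {u..v} \<and>
    \<bar>X v - X u\<bar> \<le> integral {u..v} (\<lambda>t. \<bar>deriv X t\<bar>)"
  proof cases
    case 1
    then obtain c where c: "\<And>t. t \<in> {u..v} \<Longrightarrow> X t = c"
      unfolding constant_on_def by blast
    have "deriv X t = 0" if "t \<in> {u<..<v}" for t
    proof (rule DERIV_imp_deriv, rule has_field_derivative_transform_within_open)
      show "((\<lambda>_. c) has_real_derivative 0) (at t)" by simp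
    qed (use that c in \<open>auto intro: open_greaterThanLessThan\<close>)
    \<comment> \<open>At \<open>u\<close> and \<open>v\<close> the derivative depends on the motion
      outside the leg, hence the finite exceptional set. The condition \<open>k > 0\<close> avoids
      \<open>0 ^ 0 = 1\<close>; the cases 3 and 1 are used.\<close>
    then have z: "((\<lambda>t. \<bar>deriv X t\<bar> ^ k) has_integral 0) {u..v}" if "k > 0" for k
      using that by (intro has_integral_spike_finite[OF _ _ has_integral_0, where S = "{u, v}"]) auto
    have "X ` {u..v} = {c}"
      using c uv by force
    then have "leg_energy X u v = 0"
      by (simp add: leg_energy_def)
    then show ?thesis
      using z[of 3] z[of 1] c uv by (auto simp: has_integral_iff)
  next
    case 2
    then show ?thesis
      using inj_lipschitz_energy[OF uv lip _ neg] by blast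
  qed
  then show "((\<lambda>t. \<bar>deriv X t\<bar> ^ 3) has_integral leg_energy X u v) {u..v}"
    and "(\<lambda>t. \<bar>deriv X t\<bar>) integrable_on {u..v}"
    and "\<bar>X v - X u\<bar> \<le> integral {u..v} (\<lambda>t. \<bar>deriv X t\<bar>)"
    by auto
qed

section \<open>Energy of a whole trajectory\<close>

text \<open>The time integrals add up over adjacent intervals, and displacements obey the triangle
  inequality.\<close>

lemma uses_energy_has_integral:
  assumes "uses_energy X u v E" "b-lipschitz_on {u..v} X"
  shows "u \<le> v \<and> ((\<lambda>t. \<bar>deriv X t\<bar> ^ 3) has_integral E) {u..v} \<and>
    (\<lambda>t. \<bar>deriv X t\<bar>) integrable_on {u..v} \<and>
    \<bar>X v - X u\<bar> \<le> integral {u..v} (\<lambda>t. \<bar>deriv X t\<bar>)"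
proof -
  \<comment> \<open>Proved beforehand because the main induction would be circular: restricting the
    Lipschitz condition to either part requires the order of the other part's endpoints.\<close>
  have le: "u \<le> v" if "uses_energy X u v E" for u v E
    using that by induction (auto simp: leg_def)
  show ?thesis
    using assms
  proof induction
    case (single u v)
    then show ?case
      using leg_has_integral[of X u v b] by (auto simp: leg_def)
  next
    case (successive u v E w F)
    have uv: "u \<le> v" and vw: "v \<le> w"
      using successive.hyps le by auto
    have 1: "((\<lambda>t. \<bar>deriv X t\<bar> ^ 3) has_integral E) {u..v}" "(\<lambda>t. \<bar>deriv X t\<bar>) integrable_on {u..v}"
      "\<bar>X v - X u\<bar> \<le> integral {u..v} (\<lambda>t. \<bar>deriv X t\<bar>)"
      using successive.IH(1) lipschitz_on_subset[OF successive.prems, of "{u..v}"] uv vw by auto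
    have 2: "((\<lambda>t. \<bar>deriv X t\<bar> ^ 3) has_integral F) {v..w}" "(\<lambda>t. \<bar>deriv X t\<bar>) integrable_on {v..w}"
      "\<bar>X w - X v\<bar> \<le> integral {v..w} (\<lambda>t. \<bar>deriv X t\<bar>)"
      using successive.IH(2) lipschitz_on_subset[OF successive.prems, of "{v..w}"] uv vw by auto
    have 3: "(\<lambda>t. \<bar>deriv X t\<bar>) integrable_on {u..w}"
      using Henstock_Kurzweil_Integration.integrable_combine[OF uv vw 1(2) 2(2)] .
    show ?case
      using has_integral_combine[OF uv vw 1(1) 2(1)] 3 uv vw 1(3) 2(3)
        Henstock_Kurzweil_Integration.integral_combine[OF uv vw 3]
      by auto
  qed
qed

text \<open>The time integral does not mention the legs, so every decomposition yields the same
  value. This makes the definite description in \<open>energy\<close> well defined.\<close>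

lemma trajectory_energy_has_integral:
  assumes X: "trajectory b X" and T: "0 \<le> T"
  shows "((\<lambda>t. \<bar>deriv X t\<bar> ^ 3) has_integral energy X T) {0..T}"
    and "(\<lambda>t. \<bar>deriv X t\<bar>) integrable_on {0..T}"
    and "\<bar>X T\<bar> \<le> integral {0..T} (\<lambda>t. \<bar>deriv X t\<bar>)"
proof -
  have lip: "b-lipschitz_on {0..T} X" and X0: "X 0 = 0"
    using X by (auto simp: trajectory_def intro: lipschitz_on_subset)
  obtain E where E: "uses_energy X 0 T E"
    using X T by (auto simp: trajectory_def)
  note E_int = uses_energy_has_integral[OF E lip]
  have "F = E" if "uses_energy X 0 T F" for F
    using uses_energy_has_integral[OF that lip] E_int has_integral_unique by blast
  with E have "energy X T = E"
    unfolding energy_def by (intro the_equality)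
  with E_int X0 show "((\<lambda>t. \<bar>deriv X t\<bar> ^ 3) has_integral energy X T) {0..T}"
    and "(\<lambda>t. \<bar>deriv X t\<bar>) integrable_on {0..T}"
    and "\<bar>X T\<bar> \<le> integral {0..T} (\<lambda>t. \<bar>deriv X t\<bar>)"
    by auto
qed

section \<open>Lower bounds on energy and evacuation time\<close>

text \<open>The lower bound is the tangent to the cube at \<open>s = l\<close>; the gap has a double
  zero there and factors accordingly.\<close>

lemma cube_ge_tangent:
  fixes s l :: real
  assumes "0 \<le> s" "0 \<le> l"
  shows "3 * l\<^sup>2 * s - 2 * l ^ 3 \<le> s ^ 3"
proof -
  have "0 \<le> (s - l)\<^sup>2 * (s + 2 * l)"
    using assms by simp
  also have "\<dots> = s ^ 3 - (3 * l\<^sup>2 * s - 2 * l ^ 3)"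
    by (simp add: power2_eq_square power3_eq_cube algebra_simps)
  finally show ?thesis
    by simp
qed

lemma trajectory_energy_lower_bound:
  assumes X: "trajectory b X" and T: "0 < T"
  shows "\<bar>X T\<bar> ^ 3 / T\<^sup>2 \<le> energy X T"
proof -
  \<comment> \<open>The average speed is the tangent point that maximizes 3 l^2 d - 2 l^3 T for d =
    |X T|.\<close>
  define l where "l = \<bar>X T\<bar> / T"
  have l: "0 \<le> l" "\<bar>X T\<bar> = l * T"
    using T by (auto simp: l_def)
  note E = trajectory_energy_has_integral[OF X, of T]
  have "((\<lambda>t. 3 * l\<^sup>2 * \<bar>deriv X t\<bar> - 2 * l ^ 3) has_integral
      3 * l\<^sup>2 * integral {0..T} (\<lambda>t. \<bar>deriv X t\<bar>) - T * (2 * l ^ 3)) {0..T}"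
    using E(2) T has_integral_const_real[of "2 * l ^ 3" 0 T]
    by (intro has_integral_diff has_integral_mult_right) (auto simp: has_integral_integral)
  then have "3 * l\<^sup>2 * integral {0..T} (\<lambda>t. \<bar>deriv X t\<bar>) - T * (2 * l ^ 3) \<le> energy X T"
    by (rule has_integral_le[OF _ E(1)]) (use T l in \<open>auto intro: cube_ge_tangent\<close>)
  moreover have "3 * l\<^sup>2 * (l * T) \<le> 3 * l\<^sup>2 * integral {0..T} (\<lambda>t. \<bar>deriv X t\<bar>)"
    using E(3) T l by (intro mult_left_mono) auto
  ultimately have "l ^ 3 * T \<le> energy X T"
    by (simp add: power2_eq_square power3_eq_cube algebra_simps)
  moreover have "\<bar>X T\<bar> ^ 3 / T\<^sup>2 = l ^ 3 * T"
    using T by (simp add: l(2) power2_eq_square power3_eq_cube)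
  ultimately show ?thesis
    by simp
qed

text \<open>The infimum is attained because the set of times at the exit is nonempty and, by
  continuity, closed; it is positive because the robot starts at 0.\<close>

lemma at_exit_at_arrival_time:
  assumes A: "evacuation_algorithm b A" and p: "p \<noteq> 0"
  shows "0 < arrival_time A p i" and "A (Some p) i (arrival_time A p i) = p"
proof -
  let ?X = "A (Some p) i" and ?S = "{t. 0 \<le> t \<and> A (Some p) i t = p}"
  have X: "trajectory b ?X" and ne: "?S \<noteq> {}"
    using A p by (auto simp: evacuation_algorithm_def)
  have "continuous_on {0..} ?X"
    using X by (auto simp: trajectory_def intro: lipschitz_on_continuous_on)
  then have "closed ({0..} \<inter> ?X -` {p})"
    by (intro continuous_closed_preimage) auto
  moreover have "{0..} \<inter> ?X -` {p} = ?S"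
    by auto
  ultimately have "Inf ?S \<in> ?S"
    using ne by (intro closed_contains_Inf) (auto intro: bdd_belowI)
  then have at: "0 \<le> arrival_time A p i" "?X (arrival_time A p i) = p"
    by (auto simp: arrival_time_def)
  moreover have "arrival_time A p i \<noteq> 0"
    using at(2) X p by (auto simp: trajectory_def)
  ultimately show "0 < arrival_time A p i" "?X (arrival_time A p i) = p"
    by auto
qed

lemma evacuation_time_lower_bound:
  assumes A: "A \<in> W b e" and e: "e > 0" and p: "p \<noteq> 0"
  shows "1 / sqrt e * \<bar>p\<bar> powr (3/2) \<le> evacuation_time A p"
proof -
  define T where "T = evacuation_time A p"
  have alg: "evacuation_algorithm b A"
    using A by (simp add: W_def)
  have "\<forall>d>0. makespan_energy A d \<le> e \<and> makespan_energy A (- d) \<le> e"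
    using A by (simp add: W_def)
  from this[rule_format, of "\<bar>p\<bar>"] have "makespan_energy A p \<le> e"
    using p by (cases "p < 0") auto
  then have energy: "energy (A (Some p) i) T \<le> e" for i
    by (cases i) (auto simp: makespan_energy_def T_def)
  \<comment> \<open>Take a robot that arrives last: it is at the exit exactly at time
    \<open>T\<close>, whereas one that arrived earlier may have left again.\<close>
  obtain i where "T = arrival_time A p i"
    unfolding T_def evacuation_time_def max_def by metis
  then have T: "0 < T" "A (Some p) i T = p"
    using at_exit_at_arrival_time[OF alg p] by auto
  have "trajectory b (A (Some p) i)"
    using alg p by (simp add: evacuation_algorithm_def)
  from trajectory_energy_lower_bound[OF this T(1)] energy[of i]
  have "\<bar>p\<bar> ^ 3 / T\<^sup>2 \<le> e"
    using T by simp
  then have "\<bar>p\<bar> ^ 3 / e \<le> T\<^sup>2"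
    using e T by (simp add: field_simps)
  moreover have "(1 / sqrt e * \<bar>p\<bar> powr (3/2))\<^sup>2 = \<bar>p\<bar> ^ 3 / e"
    using e p powr_realpow[of "\<bar>p\<bar>" 3]
    by (simp add: power_mult_distrib power_divide powr_power)
  ultimately have "(1 / sqrt e * \<bar>p\<bar> powr (3/2))\<^sup>2 \<le> T\<^sup>2"
    by simp
  then show ?thesis
    using T(1) unfolding T_def by (rule power2_le_imp_le[OF _ less_imp_le])
qed

theorem theorem4:
  fixes b e :: real
  assumes "b > 0" and "e > 0"
  shows "(\<exists>c>0. \<forall>\<^sub>F d in at_top. ereal (c * d powr (3/2)) \<le> optimal_evacuation_time b e d) \<and>
    (\<forall>A\<in>W b e. evacuation_time A \<in> \<Omega>[at_infinity](\<lambda>p. \<bar>p\<bar> powr (3/2)))"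
proof (intro conjI ballI)
  \<comment> \<open>The bound holds for each algorithm and so passes to the infimum, also when
    \<open>W b e\<close> is empty; of the two placements, \<open>d\<close> alone suffices.\<close>
  have "ereal (1 / sqrt e * d powr (3/2)) \<le> optimal_evacuation_time b e d" if "d > 0" for d
    unfolding optimal_evacuation_time_def
  proof (rule INF_greatest)
    fix A assume "A \<in> W b e"
    then have "1 / sqrt e * d powr (3/2) \<le> evacuation_time A d"
      using evacuation_time_lower_bound[of A b e d] assms that by simp
    then show "ereal (1 / sqrt e * d powr (3/2)) \<le>
        ereal (max (evacuation_time A d) (evacuation_time A (- d)))"
      unfolding ereal_less_eq by (rule max.coboundedI1)
  qed
  then have "\<forall>\<^sub>F d in at_top. ereal (1 / sqrt e * d powr (3/2)) \<le> optimal_evacuation_time b e d"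
    by (intro eventually_mono[OF eventually_gt_at_top[of 0]])
  then show "\<exists>c>0. \<forall>\<^sub>F d in at_top. ereal (c * d powr (3/2)) \<le> optimal_evacuation_time b e d"
    using assms by (intro exI[of _ "1 / sqrt e"]) simp
next
  fix A assume A: "A \<in> W b e"
  \<comment> \<open>On the reals \<open>at_infinity\<close> covers both directions, hence both
    placements of a distant exit.\<close>
  have "\<forall>\<^sub>F p in at_infinity. p \<noteq> (0::real)"
    unfolding eventually_at_infinity by (intro exI[of _ 1]) auto
  then have "\<forall>\<^sub>F p in at_infinity. 1 / sqrt e * norm (\<bar>p\<bar> powr (3/2)) \<le> norm (evacuation_time A p)"
  proof eventually_elim
    case (elim p)
    then show ?case
      using evacuation_time_lower_bound[OF A \<open>e > 0\<close>, of p] by simp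
  qed
  then show "evacuation_time A \<in> \<Omega>[at_infinity](\<lambda>p. \<bar>p\<bar> powr (3/2))"
    using assms by (intro landau_omega.bigI[of "1 / sqrt e"]) auto
qed

end
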